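(* Let $\mathbb{F}$ be a field, let $n\geq 2$, let $y\in\mathbb{F}$ and let $x\in\mathbb{F}^{\times}$. Then the $n\times n$ Zhang–Liu matrix $Q(y,x)$ is diagonalizable over $\mathbb{F}$ if and only if $x\notin\{-1,1\}$ or $y=0$.
   Context: The convention $0^0=1$ is used. For $y\in\mathbb{F}$, $x\in\mathbb{F}^{\times}$, the Zhang–Liu matrix $Q(y,x)$ is the $n\times n$ matrix whose $(i,j)$ entry ($1\le i,j\le n$) is $y^{j-i}x^{j+i-2}\binom{j-1}{i-1}$ if $j\geq i$ and $0$ otherwise. *)

theory Defs
  imports "Jordan_Normal_Form.Matrix"
begin

text \<open>Row and column indices of \<^typ>\<open>'a mat\<close> start at 0, so the entry function below, which
  uses indices starting at 1, is evaluated at the successors. HOL's power satisfies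
  \<open>0 ^ 0 = 1\<close>.\<close>

definition zhang_liu_entry :: "'a::field \<Rightarrow> 'a \<Rightarrow> nat \<Rightarrow> nat \<Rightarrow> 'a" where
  "zhang_liu_entry y x i j =
     (if j \<ge> i then y ^ (j - i) * x ^ (j + i - 2) * of_nat ((j - 1) choose (i - 1)) else 0)"

definition zhang_liu_mat :: "nat \<Rightarrow> 'a::field \<Rightarrow> 'a \<Rightarrow> 'a mat" where
  "zhang_liu_mat n y x = mat n n (\<lambda>(i, j). zhang_liu_entry y x (i + 1) (j + 1))"

text \<open>Since \<^const>\<open>similar_mat\<close> asks for the transition matrices over the same type \<open>'a\<close>, this is
  diagonalizability over the field \<open>'a\<close> itself.\<close>

definition diagonalizable_mat :: "'a::field mat \<Rightarrow> bool" where
  "diagonalizable_mat A \<longleftrightarrow> (\<exists>D. diagonal_mat D \<and> similar_mat A D)"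

end

theory Submission
  imports Defs "Jordan_Normal_Form.Char_Poly"
begin

text \<open>Column \<open>j\<close> of \<open>Q(y, x)\<close>, counted from 0, lists the coefficients of \<open>(x\<^sup>2 t + x y) ^ j\<close>, so
  \<open>Q(y, x)\<close> represents the substitution \<open>t \<mapsto> x\<^sup>2 t + x y\<close> on polynomials of degree less than \<open>n\<close>.
  If \<open>x\<^sup>2 \<noteq> 1\<close>, this affine map has the fixed point \<open>c = x y / (1 - x\<^sup>2)\<close>, and the powers of
  \<open>t - c\<close> form a basis of eigenvectors, even if the eigenvalues \<open>x ^ (2 j)\<close> are not distinct.
  If \<open>x\<^sup>2 = 1\<close>, the matrix is unipotent, hence diagonalizable only if it is the identity, and its
  entry in the first row and second column is \<open>x y\<close>.\<close>

definition affine_subst_mat :: "nat \<Rightarrow> 'a::comm_ring_1 \<Rightarrow> 'a \<Rightarrow> 'a mat" where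
  "affine_subst_mat n a b = mat n n (\<lambda>(i, j). coeff ([:b, a:] ^ j) i)"

lemma affine_subst_mat_carrier [simp]: "affine_subst_mat n a b \<in> carrier_mat n n"
  by (simp add: affine_subst_mat_def)

lemma degree_linear_power_le: "degree ([:b, a:] ^ j) \<le> j"
  for a b :: "'a::comm_ring_1"
  using degree_power_le[of "[:b, a:]" j] by (auto intro: order_trans split: if_splits)

text \<open>The sum runs to an arbitrary bound above the degree, so that it has the index range of a
  product of \<open>n \<times> n\<close> matrices.\<close>

lemma pcompose_conv_sum_powers:
  fixes p q :: "'a::comm_ring_1 poly"
  assumes "degree p < n"
  shows "pcompose p q = (\<Sum>k<n. smult (coeff p k) (q ^ k))"
proof -
  have q: "pcompose (monom c k) q = smult c (q ^ k)" for c k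
    by (induction k) (simp_all add: monom_0 monom_Suc pcompose_pCons mult.commute)
  have "(\<Sum>k<n. monom (coeff p k) k) = p"
    using assms poly_as_sum_of_monoms'[of p "n - 1"]
    by (cases n) (auto simp: lessThan_Suc_atMost)
  then have "pcompose p q = pcompose (\<Sum>k<n. monom (coeff p k) k) q"
    by simp
  then show ?thesis
    by (simp add: pcompose_sum q)
qed

lemma pcompose_power: "pcompose (p ^ k) q = pcompose p q ^ k"
  for p q :: "'a::comm_semiring_1 poly"
  by (induction k) (simp_all add: pcompose_1 pcompose_mult)

text \<open>Multiplying by the left factor substitutes its linear polynomial into the columns of the
  right one. Substitution respects powers, and \<open>j < n\<close> keeps all degrees below
  \<open>n\<close>, so nothing is truncated.\<close>

lemma affine_subst_mat_mult:
  "affine_subst_mat n a b * affine_subst_mat n a' b' = affine_subst_mat n (a * a') (b' + a' * b)"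
proof (rule eq_matI)
  fix i j
  assume "i < dim_row (affine_subst_mat n (a * a') (b' + a' * b))"
    and "j < dim_col (affine_subst_mat n (a * a') (b' + a' * b))"
  then have ij: "i < n" "j < n"
    by (simp_all add: affine_subst_mat_def)
  let ?p = "[:b', a':] ^ j"
  have "(affine_subst_mat n a b * affine_subst_mat n a' b') $$ (i, j)
      = (\<Sum>k<n. coeff ([:b, a:] ^ k) i * coeff ?p k)"
    using ij by (simp add: affine_subst_mat_def scalar_prod_def atLeast0LessThan)
  also have "\<dots> = coeff (\<Sum>k<n. smult (coeff ?p k) ([:b, a:] ^ k)) i"
    by (simp add: coeff_sum mult.commute)
  also have "\<dots> = coeff (pcompose ?p [:b, a:]) i"
    using ij degree_linear_power_le[of b' a' j]
    by (subst pcompose_conv_sum_powers[of _ n]) auto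
  also have "pcompose ?p [:b, a:] = [:b' + a' * b, a * a':] ^ j"
    by (simp add: pcompose_power pcompose_pCons mult.commute)
  finally show "(affine_subst_mat n a b * affine_subst_mat n a' b') $$ (i, j)
      = affine_subst_mat n (a * a') (b' + a' * b) $$ (i, j)"
    using ij by (simp add: affine_subst_mat_def)
qed (simp_all add: affine_subst_mat_def)

lemma coeff_scaled_var_power: "coeff ([:0, a:] ^ j) i = (if i = j then a ^ j else 0)"
  for a :: "'a::comm_ring_1"
proof -
  have "[:0, a:] ^ j = monom (a ^ j) j"
    by (simp add: monom_altdef flip: smult_power)
  then show ?thesis
    by simp
qed

lemma affine_subst_mat_one: "affine_subst_mat n 1 0 = 1\<^sub>m n"
  by (rule eq_matI) (simp_all add: affine_subst_mat_def coeff_scaled_var_power)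

lemma diagonal_affine_subst_mat: "diagonal_mat (affine_subst_mat n a 0)"
  by (simp add: diagonal_mat_def affine_subst_mat_def coeff_scaled_var_power)

lemma zhang_liu_mat_conv_affine_subst_mat:
  "zhang_liu_mat n y x = affine_subst_mat n (x\<^sup>2) (x * y)"
proof (rule eq_matI)
  fix i j
  assume "i < dim_row (affine_subst_mat n (x\<^sup>2) (x * y))"
    and "j < dim_col (affine_subst_mat n (x\<^sup>2) (x * y))"
  then have ij: "i < n" "j < n"
    by (simp_all add: affine_subst_mat_def)
  have "zhang_liu_entry y x (i + 1) (j + 1) = coeff ([:x * y, x\<^sup>2:] ^ j) i"
  proof (cases "i \<le> j")
    case True
    \<comment> \<open>This splitting matches the entry with the binomial term
      \<open>(x\<^sup>2) ^ i * (x * y) ^ (j - i)\<close>.\<close>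
    then have "x ^ (j + i) = (x\<^sup>2) ^ i * x ^ (j - i)"
      by (simp add: add.commute flip: power_mult power_add)
    with True show ?thesis
      by (simp add: zhang_liu_entry_def coeff_linear_poly_power power_mult_distrib ac_simps)
  next
    case False
    then have "degree ([:x * y, x\<^sup>2:] ^ j) < i"
      using degree_linear_power_le[of "x * y" "x\<^sup>2" j] by simp
    with False show ?thesis
      by (simp add: zhang_liu_entry_def coeff_eq_0)
  qed
  with ij show "zhang_liu_mat n y x $$ (i, j) = affine_subst_mat n (x\<^sup>2) (x * y) $$ (i, j)"
    by (simp add: zhang_liu_mat_def affine_subst_mat_def)
qed (simp_all add: zhang_liu_mat_def affine_subst_mat_def)

text \<open>Conjugation by the translation that moves the fixed point \<open>c\<close> to 0 leaves
  the pure scaling by \<open>a\<close>. The columns of \<open>?S 1 (- c)\<close> are the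
  eigenvectors, the powers of \<open>t - c\<close>.\<close>

lemma diagonalizable_affine_subst_mat:
  fixes a b c :: "'a::field"
  assumes fixpoint: "a * c + b = c"
  shows "diagonalizable_mat (affine_subst_mat n a b)"
proof -
  let ?S = "affine_subst_mat n"
  have b: "c - a * c = b"
    using fixpoint by (simp add: algebra_simps)
  have "?S 1 (- c) * ?S a 0 * ?S 1 c = ?S a b"
    by (simp add: affine_subst_mat_mult flip: b)
  moreover have "?S 1 (- c) * ?S 1 c = 1\<^sub>m n" "?S 1 c * ?S 1 (- c) = 1\<^sub>m n"
    by (simp_all add: affine_subst_mat_mult affine_subst_mat_one)
  ultimately have "similar_mat (?S a b) (?S a 0)"
    by (intro similar_matI[where n = n and P = "?S 1 (- c)" and Q = "?S 1 c"]) simp_all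
  then show ?thesis
    unfolding diagonalizable_mat_def using diagonal_affine_subst_mat by blast
qed

text \<open>Similar matrices share the characteristic polynomial, here \<open>(t - 1) ^ n\<close>.
  Hence \<open>D\<close> has only ones on its diagonal, and \<open>A = P * D * Q\<close> collapses
  to \<open>P * Q\<close>.\<close>

lemma diagonalizable_unipotent_upper_triangular:
  fixes A :: "'a::field mat"
  assumes A: "A \<in> carrier_mat n n" "upper_triangular A" "\<And>i. i < n \<Longrightarrow> A $$ (i, i) = 1"
    and diag: "diagonalizable_mat A"
  shows "A = 1\<^sub>m n"
proof -
  obtain D where D: "diagonal_mat D" "similar_mat A D"
    using diag by (auto simp: diagonalizable_mat_def)
  obtain P Q where c: "D \<in> carrier_mat n n" "P \<in> carrier_mat n n" "Q \<in> carrier_mat n n"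
    and PQ: "P * Q = 1\<^sub>m n" and APDQ: "A = P * D * Q"
    using D(2) A(1) by (auto simp: similar_mat_def similar_mat_wit_def Let_def)
  have "upper_triangular D"
    using D(1) c(1) by (auto simp: diagonal_mat_def)
  then have "(\<Prod>a\<leftarrow>diag_mat D. [:- a, 1:]) = (\<Prod>a\<leftarrow>diag_mat A. [:- a, 1:])"
    using char_poly_similar[OF D(2)] char_poly_upper_triangular[OF A(1,2)]
      char_poly_upper_triangular[OF c(1)] by simp
  also have "diag_mat A = replicate n 1"
    using A by (auto simp: diag_mat_def intro: nth_equalityI)
  finally have char: "(\<Prod>a\<leftarrow>diag_mat D. [:- a, 1:]) = [:- 1, 1:] ^ n"
    by (simp add: prod_list_replicate)
  have "D $$ (i, i) = 1" if "i < n" for i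
  proof -
    have "D $$ (i, i) \<in> set (diag_mat D)"
      using that c(1) by (auto simp: diag_mat_def)
    then have "poly ([:- 1, 1:] ^ n) (D $$ (i, i)) = 0"
      unfolding char[symmetric] by (auto simp: poly_prod_list prod_list_zero_iff)
    then show ?thesis
      by simp
  qed
  then have "D = 1\<^sub>m n"
    using D(1) c(1) by (intro eq_matI) (auto simp: diagonal_mat_def)
  then show ?thesis
    using APDQ PQ c by simp
qed

theorem theorem3:
  fixes x y :: "'a::field" and n :: nat
  assumes "n \<ge> 2" and "x \<noteq> 0"
  shows "diagonalizable_mat (zhang_liu_mat n y x) \<longleftrightarrow> x \<notin> {-1, 1} \<or> y = 0"
proof
  assume diag: "diagonalizable_mat (zhang_liu_mat n y x)"
  show "x \<notin> {-1, 1} \<or> y = 0"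
  proof (cases "x \<in> {-1, 1}")
    case True
    let ?A = "zhang_liu_mat n y x"
    have "?A = 1\<^sub>m n"
    proof (rule diagonalizable_unipotent_upper_triangular[OF _ _ _ diag])
      fix i
      assume "i < n"
      \<comment> \<open>The diagonal entry is \<open>x ^ (2 * i)\<close>; the even exponent makes
        both signs of \<open>x\<close> give 1.\<close>
      then show "?A $$ (i, i) = 1"
        using True by (auto simp: zhang_liu_mat_def zhang_liu_entry_def)
    qed (auto simp: zhang_liu_mat_def zhang_liu_entry_def)
    \<comment> \<open>Column 1 exists because \<open>n \<ge> 2\<close>.\<close>
    then have "?A $$ (0, 1) = 1\<^sub>m n $$ (0, 1)"
      by simp
    then have "y * x = 0"
      using assms(1) by (simp add: zhang_liu_mat_def zhang_liu_entry_def)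
    with assms(2) show ?thesis
      by simp
  qed simp
next
  assume *: "x \<notin> {-1, 1} \<or> y = 0"
  have "\<exists>c. x\<^sup>2 * c + x * y = c"
  \<comment> \<open>For \<open>y = 0\<close> the point 0 is fixed even if
    \<open>x\<^sup>2 = 1\<close>, where the division by \<open>1 - x\<^sup>2\<close> of the other
    case would fail.\<close>
  proof (cases "y = 0")
    case True
    then have "x\<^sup>2 * 0 + x * y = 0"
      by simp
    then show ?thesis ..
  next
    case False
    with * have "1 - x\<^sup>2 \<noteq> 0"
      by (simp add: power2_eq_1_iff)
    then have "x\<^sup>2 * (x * y / (1 - x\<^sup>2)) + x * y = x * y / (1 - x\<^sup>2)"
      by (simp add: field_simps)
    then show ?thesis ..
  qed
  then show "diagonalizable_mat (zhang_liu_mat n y x)"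
    unfolding zhang_liu_mat_conv_affine_subst_mat by (auto intro: diagonalizable_affine_subst_mat)
qed

end
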